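(* Let $S=\{C_1,\dots,C_n\}$ be a finite set of first-order clauses and let $\phi_1,\phi_2,\dots,\phi_t$ be a deduction sequence of contradiction separation based on standard extension from $S$ to $\phi_t$. If $\phi_t=\emptyset$, then $S$ is unsatisfiable.
   Context: First-order logic. A literal is an atom or its negation; $A$ and $\neg A$ (same atom) are complementary. A clause is a finite set of literals (disjunction) with its variables implicitly universally quantified; $\emptyset$ is the empty clause; $S$ is unsatisfiable if the conjunction of the universal closures of its clauses has no model. For a substitution $\theta$, $D^\theta$ is the clause obtained by applying $\theta$ to each literal of $D$ and merging identical literals. Contradiction separation based on standard extension: let $m\ge2$, let $D_1,\dots,D_m$ be clauses (repetitions allowed, variables renamed so that no two share variables), $\theta_1,\dots,\theta_m$ substitutions, $L_1,\dots,L_{m-1}$ literals, and sub-clauses $D_i^{\theta_i-}\subseteq D_i^{\theta_i}$ with $D_1^{\theta_1-}=\{L_1\}$, $D_i^{\theta_i-}=\{L_i,\neg L_{i-1}\}\cup E^i$ for $2\le i\le m-1$, $D_m^{\theta_m-}=\{\neg L_{m-1}\}\cup E^m$, where $E^2=\emptyset$ and $E^j\subseteq\{\neg L_1,\dots,\neg L_{j-2}\}$ for $3\le j\le m$. Then $R_s(D_1^{\theta_1},\dots,D_m^{\theta_m})=\bigcup_{i=1}^m(D_i^{\theta_i}\setminus D_i^{\theta_i-})$ is a contradiction separation clause based on standard extension. A deduction sequence of contradiction separation based on standard extension from $S$ to $\phi_t$ is a sequence of clauses $\phi_1,\dots,\phi_t$ where each $\phi_i$ either lies in $S$ or there are indices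 $r_1,\dots,r_{k_i}<i$ and substitutions such that $\phi_i$ is a contradiction separation clause based on standard extension of the corresponding instances of $\phi_{r_1},\dots,\phi_{r_{k_i}}$. *)

theory Defs
  imports Main
begin

text \<open>
  Symbols carry no fixed arity: a symbol applied to argument lists of different lengths acts
  as different symbols, so every ranked signature embeds.
\<close>

datatype ('f, 'v) fterm = Var 'v | Fun 'f "('f, 'v) fterm list"

datatype ('f, 'p, 'v) atom = Pred 'p "('f, 'v) fterm list"

datatype ('f, 'p, 'v) literal = Pos "('f, 'p, 'v) atom" | Neg "('f, 'p, 'v) atom"

fun compl :: "('f, 'p, 'v) literal \<Rightarrow> ('f, 'p, 'v) literal" where
  "compl (Pos A) = Neg A"
| "compl (Neg A) = Pos A"

text \<open>Finiteness of clauses is stated explicitly wherever it is required.\<close>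

type_synonym ('f, 'p, 'v) clause = "('f, 'p, 'v) literal set"

type_synonym ('f, 'v) subst = "'v \<Rightarrow> ('f, 'v) fterm"


fun subst_term :: "('f, 'v) fterm \<Rightarrow> ('f, 'v) subst \<Rightarrow> ('f, 'v) fterm" where
  "subst_term (Var x) \<theta> = \<theta> x"
| "subst_term (Fun f ts) \<theta> = Fun f (map (\<lambda>t. subst_term t \<theta>) ts)"

fun subst_atom :: "('f, 'p, 'v) atom \<Rightarrow> ('f, 'v) subst \<Rightarrow> ('f, 'p, 'v) atom" where
  "subst_atom (Pred p ts) \<theta> = Pred p (map (\<lambda>t. subst_term t \<theta>) ts)"

fun subst_literal :: "('f, 'p, 'v) literal \<Rightarrow> ('f, 'v) subst \<Rightarrow> ('f, 'p, 'v) literal" where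
  "subst_literal (Pos A) \<theta> = Pos (subst_atom A \<theta>)"
| "subst_literal (Neg A) \<theta> = Neg (subst_atom A \<theta>)"

definition subst_clause :: "('f, 'p, 'v) clause \<Rightarrow> ('f, 'v) subst \<Rightarrow> ('f, 'p, 'v) clause" where
  "subst_clause C \<theta> = (\<lambda>l. subst_literal l \<theta>) ` C"


fun vars_term :: "('f, 'v) fterm \<Rightarrow> 'v set" where
  "vars_term (Var x) = {x}"
| "vars_term (Fun f ts) = (\<Union>t\<in>set ts. vars_term t)"

fun vars_atom :: "('f, 'p, 'v) atom \<Rightarrow> 'v set" where
  "vars_atom (Pred p ts) = (\<Union>t\<in>set ts. vars_term t)"

fun vars_literal :: "('f, 'p, 'v) literal \<Rightarrow> 'v set" where
  "vars_literal (Pos A) = vars_atom A"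
| "vars_literal (Neg A) = vars_atom A"

definition vars_clause :: "('f, 'p, 'v) clause \<Rightarrow> 'v set" where
  "vars_clause C = (\<Union>l\<in>C. vars_literal l)"

definition variant_of :: "('f, 'p, 'v) clause \<Rightarrow> ('f, 'p, 'v) clause \<Rightarrow> bool" where
  "variant_of D C \<longleftrightarrow>
     (\<exists>\<rho>. inj_on \<rho> (vars_clause C) \<and> D = subst_clause C (\<lambda>x. Var (\<rho> x)))"


record ('f, 'p, 'u) struct =
  univ :: "'u set"
  intF :: "'f \<Rightarrow> 'u list \<Rightarrow> 'u"
  intP :: "'p \<Rightarrow> 'u list \<Rightarrow> bool"

definition is_struct :: "('f, 'p, 'u) struct \<Rightarrow> bool" where
  "is_struct M \<longleftrightarrow>
     univ M \<noteq> {} \<and> (\<forall>f us. set us \<subseteq> univ M \<longrightarrow> intF M f us \<in> univ M)"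

fun eval_term :: "('f, 'p, 'u) struct \<Rightarrow> ('v \<Rightarrow> 'u) \<Rightarrow> ('f, 'v) fterm \<Rightarrow> 'u" where
  "eval_term M \<sigma> (Var x) = \<sigma> x"
| "eval_term M \<sigma> (Fun f ts) = intF M f (map (eval_term M \<sigma>) ts)"

fun true_atom :: "('f, 'p, 'u) struct \<Rightarrow> ('v \<Rightarrow> 'u) \<Rightarrow> ('f, 'p, 'v) atom \<Rightarrow> bool" where
  "true_atom M \<sigma> (Pred p ts) \<longleftrightarrow> intP M p (map (eval_term M \<sigma>) ts)"

fun true_literal :: "('f, 'p, 'u) struct \<Rightarrow> ('v \<Rightarrow> 'u) \<Rightarrow> ('f, 'p, 'v) literal \<Rightarrow> bool" where
  "true_literal M \<sigma> (Pos A) \<longleftrightarrow> true_atom M \<sigma> A"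
| "true_literal M \<sigma> (Neg A) \<longleftrightarrow> \<not> true_atom M \<sigma> A"

text \<open>Truth of the universal closure: every assignment into the domain satisfies some literal.\<close>

definition true_clause :: "('f, 'p, 'u) struct \<Rightarrow> ('f, 'p, 'v) clause \<Rightarrow> bool" where
  "true_clause M C \<longleftrightarrow> (\<forall>\<sigma>. range \<sigma> \<subseteq> univ M \<longrightarrow> (\<exists>l\<in>C. true_literal M \<sigma> l))"

definition is_model :: "('f, 'p, 'u) struct \<Rightarrow> ('f, 'p, 'v) clause set \<Rightarrow> bool" where
  "is_model M S \<longleftrightarrow> is_struct M \<and> (\<forall>C\<in>S. true_clause M C)"

text \<open>
  HOL cannot quantify over types inside a formula, so the type from which the domains are drawn
  is a parameter.  A theorem concluding \<open>unsatisfiable TYPE('u) S\<close> with \<open>'u\<close> a free type variable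
  not occurring in its hypotheses covers domains of every type.
\<close>

definition unsatisfiable :: "'u itself \<Rightarrow> ('f, 'p, 'v) clause set \<Rightarrow> bool" where
  "unsatisfiable _ S \<longleftrightarrow> (\<nexists>M :: ('f, 'p, 'u) struct. is_model M S)"


text \<open>
  \<open>R\<close> is a contradiction separation clause based on standard extension of the instances
  \<open>D i\<close> under \<open>\<theta> i\<close>.  Families are functions on natural numbers of which only the values at
  the indices 1 to \<open>m\<close> matter; \<open>Dm i\<close> is the sub-clause taken from the \<open>i\<close>-th instance.
\<close>

definition cs_std_ext ::
  "nat \<Rightarrow> (nat \<Rightarrow> ('f, 'p, 'v) clause) \<Rightarrow> (nat \<Rightarrow> ('f, 'v) subst) \<Rightarrow> ('f, 'p, 'v) clause \<Rightarrow> bool"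
where
  "cs_std_ext m D \<theta> R \<longleftrightarrow>
     2 \<le> m \<and>
     (\<forall>i\<in>{1..m}. finite (D i)) \<and>
     (\<forall>i\<in>{1..m}. \<forall>j\<in>{1..m}. i \<noteq> j \<longrightarrow> vars_clause (D i) \<inter> vars_clause (D j) = {}) \<and>
     (\<exists>L E Dm.
        (\<forall>i\<in>{1..m}. Dm i \<subseteq> subst_clause (D i) (\<theta> i)) \<and>
        Dm 1 = {L 1} \<and>
        (\<forall>i\<in>{2..m-1}. Dm i = {L i, compl (L (i-1))} \<union> E i) \<and>
        Dm m = {compl (L (m-1))} \<union> E m \<and>
        E 2 = {} \<and>
        (\<forall>j\<in>{3..m}. E j \<subseteq> (\<lambda>k. compl (L k)) ` {1..j-2}) \<and>
        R = (\<Union>i\<in>{1..m}. subst_clause (D i) (\<theta> i) - Dm i))"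

text \<open>The deduction sequence is \<open>\<phi> 1, \<dots>, \<phi> t\<close>; each premise of a step is a renamed copy
  of an earlier member.\<close>

definition cs_deduction ::
  "('f, 'p, 'v) clause set \<Rightarrow> (nat \<Rightarrow> ('f, 'p, 'v) clause) \<Rightarrow> nat \<Rightarrow> bool"
where
  "cs_deduction S \<phi> t \<longleftrightarrow>
     1 \<le> t \<and>
     (\<forall>i\<in>{1..t}.
        \<phi> i \<in> S \<or>
        (\<exists>k r D \<theta>.
           (\<forall>j\<in>{1..k}. 1 \<le> r j \<and> r j < i \<and> variant_of (D j) (\<phi> (r j))) \<and>
           cs_std_ext k D \<theta> (\<phi> i)))"

end

theory Submission imports Defs begin

text \<open>
  A contradiction separation step is sound.  If all its premises held in a structure but its
  conclusion failed under an assignment, every instance would have a true literal in its selected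
  sub-clause.  The first sub-clause makes \<open>L 1\<close> true; by induction all other literals of the
  \<open>i\<close>-th sub-clause are complements of earlier, true literals, so \<open>L i\<close> is true as well, and in
  the last sub-clause nothing is left to be true.
\<close>

lemma eval_term_subst:
  "eval_term M \<sigma> (subst_term t \<theta>) = eval_term M (\<lambda>x. eval_term M \<sigma> (\<theta> x)) t"
  by (induction t) (simp_all cong: map_cong)

lemma true_literal_subst:
  "true_literal M \<sigma> (subst_literal l \<theta>) = true_literal M (\<lambda>x. eval_term M \<sigma> (\<theta> x)) l"
proof -
  have "true_atom M \<sigma> (subst_atom A \<theta>) = true_atom M (\<lambda>x. eval_term M \<sigma> (\<theta> x)) A" for A
    by (cases A) (simp add: eval_term_subst comp_def)
  then show ?thesis by (cases l) simp_all
qed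

lemma true_literal_compl [simp]: "true_literal M \<sigma> (compl l) \<longleftrightarrow> \<not> true_literal M \<sigma> l"
  by (cases l) simp_all

text \<open>\<open>true_clause\<close> speaks only of assignments into the domain. This closure
  property makes the assignment \<open>\<lambda>x. eval_term M \<sigma> (\<theta> x)\<close> an
  admissible one.\<close>

lemma eval_term_in_univ:
  assumes "is_struct M" and "range \<sigma> \<subseteq> univ M"
  shows "eval_term M \<sigma> t \<in> univ M"
proof (induction t)
  case (Var x)
  then show ?case using assms(2) by auto
next
  case (Fun f ts)
  then have "set (map (eval_term M \<sigma>) ts) \<subseteq> univ M" by auto
  then show ?case using assms(1) by (simp add: is_struct_def)
qed

text \<open>A clause is read as universally closed, so its truth can be used at the assignment that
  first substitutes by \<open>\<theta>\<close> and then evaluates. This serves both the instances in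
  a separation step and the renamed premises.\<close>

lemma true_clause_subst:
  fixes M :: "('f, 'p, 'u) struct" and C :: "('f, 'p, 'v) clause"
  assumes "is_struct M" and "true_clause M C"
  shows "true_clause M (subst_clause C \<theta>)"
  unfolding true_clause_def
proof (intro allI impI)
  fix \<sigma> :: "'v \<Rightarrow> 'u"
  assume "range \<sigma> \<subseteq> univ M"
  then have "range (\<lambda>x. eval_term M \<sigma> (\<theta> x)) \<subseteq> univ M"
    using eval_term_in_univ[OF assms(1)] by auto
  then obtain l where "l \<in> C" "true_literal M (\<lambda>x. eval_term M \<sigma> (\<theta> x)) l"
    using assms(2) by (auto simp: true_clause_def)
  then show "\<exists>l\<in>subst_clause C \<theta>. true_literal M \<sigma> l"
    by (auto simp: subst_clause_def true_literal_subst)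
qed

lemma cs_std_ext_sound:
  fixes M :: "('f, 'p, 'u) struct" and R :: "('f, 'p, 'v) clause"
  assumes M: "is_struct M"
    and cs: "cs_std_ext m D \<theta> R"
    and D: "\<And>i. i \<in> {1..m} \<Longrightarrow> true_clause M (D i)"
  shows "true_clause M R"
  unfolding true_clause_def
proof (intro allI impI, rule ccontr)
  fix \<sigma> :: "'v \<Rightarrow> 'u"
  assume \<sigma>: "range \<sigma> \<subseteq> univ M" and no: "\<not> (\<exists>l\<in>R. true_literal M \<sigma> l)"
  obtain L E Dm where m: "2 \<le> m"
    and D1: "Dm 1 = {L 1}"
    and Di: "\<forall>i\<in>{2..m-1}. Dm i = {L i, compl (L (i-1))} \<union> E i"
    and Dm: "Dm m = {compl (L (m-1))} \<union> E m"
    and E2: "E 2 = {}"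
    and Ej: "\<forall>j\<in>{3..m}. E j \<subseteq> (\<lambda>k. compl (L k)) ` {1..j-2}"
    and R: "R = (\<Union>i\<in>{1..m}. subst_clause (D i) (\<theta> i) - Dm i)"
    using cs unfolding cs_std_ext_def by blast
  \<comment> \<open>Literals of the instance outside \<open>Dm i\<close> belong to \<open>R\<close>,
    hence are false under \<open>\<sigma>\<close>.\<close>
  have selected: "\<exists>l\<in>Dm i. true_literal M \<sigma> l" if i: "i \<in> {1..m}" for i
  proof -
    obtain l where "l \<in> subst_clause (D i) (\<theta> i)" "true_literal M \<sigma> l"
      using true_clause_subst[OF M D[OF i]] \<sigma> unfolding true_clause_def by blast
    then show ?thesis using no i unfolding R by blast
  qed
  \<comment> \<open>At \<open>j = 2\<close> the index range is \<open>{1..0}\<close>, which is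
    empty, so one bound covers \<open>E 2 = {}\<close> too.\<close>
  have E: "E j \<subseteq> (\<lambda>k. compl (L k)) ` {1..j-2}" if "j \<in> {2..m}" for j
    using that E2 Ej by (cases "j = 2") auto
  have L_true: "true_literal M \<sigma> (L i)" if "i \<in> {1..m-1}" for i
    using that
  \<comment> \<open>The induction must be strong because \<open>E i\<close> may refer to any
    \<open>L k\<close> with \<open>k \<le> i-2\<close>.\<close>
  proof (induction i rule: less_induct)
    case (less i)
    show ?case
    proof (cases "i = 1")
      case True
      then show ?thesis using selected[of 1] D1 m by auto
    next
      case False
      then have i: "i \<in> {2..m-1}" using less.prems by auto
      obtain l where l: "l \<in> Dm i" "true_literal M \<sigma> l"
        using selected[of i] less.prems by fastforce
      have "\<not> true_literal M \<sigma> (compl (L k))" if "k \<in> {1..i-1}" for k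
        using less.IH[of k] that i by auto
      \<comment> \<open>The literal \<open>compl (L (i-1))\<close> supplies the index
        \<open>i-1\<close> that \<open>E i\<close> leaves out.\<close>
      moreover have "Dm i \<subseteq> {L i} \<union> (\<lambda>k. compl (L k)) ` {1..i-1}"
        using Di i E[of i] by fastforce
      ultimately show ?thesis using l by blast
    qed
  qed
  have "Dm m \<subseteq> (\<lambda>k. compl (L k)) ` {1..m-1}"
    using Dm E[of m] m by fastforce
  then show False using selected[of m] L_true m by fastforce
qed

text \<open>Each premise of a step copies an earlier member, so strong induction on the position
  propagates truth from \<open>S\<close> along the sequence.\<close>

lemma cs_deduction_sound:
  assumes M: "is_model M S" and ded: "cs_deduction S \<phi> t" and "i \<in> {1..t}"
  shows "true_clause M (\<phi> i)"
  using \<open>i \<in> {1..t}\<close>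
proof (induction i rule: less_induct)
  case (less i)
  have struct: "is_struct M" using M by (simp add: is_model_def)
  show ?case
  proof (cases "\<phi> i \<in> S")
    case True
    then show ?thesis using M by (simp add: is_model_def)
  next
    case False
    then obtain k r D \<theta>
      where r: "\<forall>j\<in>{1..k}. 1 \<le> r j \<and> r j < i \<and> variant_of (D j) (\<phi> (r j))"
        and cs: "cs_std_ext k D \<theta> (\<phi> i)"
      using ded less.prems unfolding cs_deduction_def by blast
    have "true_clause M (D j)" if j: "j \<in> {1..k}" for j
    proof -
      have "true_clause M (\<phi> (r j))" using less.IH[of "r j"] less.prems r j by fastforce
      \<comment> \<open>A variant is the instance under
        \<open>\<lambda>x. Var (\<rho> x)\<close>.\<close>
      then show ?thesis
        using r j true_clause_subst[OF struct] unfolding variant_of_def by metis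
    qed
    then show ?thesis using cs_std_ext_sound[OF struct cs] by blast
  qed
qed

theorem theorem5p3:
  fixes S :: "('f, 'p, 'v) clause set"
    and \<phi> :: "nat \<Rightarrow> ('f, 'p, 'v) clause"
    and t :: nat
  assumes "finite S"
    and "\<forall>C\<in>S. finite C"
    and "cs_deduction S \<phi> t"
    and "\<phi> t = {}"
  shows "unsatisfiable TYPE('u) S"
  unfolding unsatisfiable_def
proof
  assume "\<exists>M :: ('f, 'p, 'u) struct. is_model M S"
  then obtain M :: "('f, 'p, 'u) struct" where M: "is_model M S" ..
  have "1 \<le> t" using assms(3) by (simp add: cs_deduction_def)
  then have "true_clause M ({} :: ('f, 'p, 'v) clause)"
    using cs_deduction_sound[OF M assms(3), of t] assms(4) by simp
  \<comment> \<open>A nonempty domain admits a constant assignment, at which the empty clause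
    fails.\<close>
  moreover obtain u where "u \<in> univ M"
    using M by (auto simp: is_model_def is_struct_def)
  ultimately show False
    unfolding true_clause_def by (auto dest: spec[of _ "\<lambda>_. u"])
qed

end
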